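(* Let $1<t<3/2$ and let $\mathcal D$ be a dyadic system on $\mathbb T$. For any $1\le p,q\le+\infty$ with $\frac1q-\frac1p<2t-2$, the operator $\mathcal M_t^{\mathcal D}$ is not bounded from $L^p(\mathbb D)$ to $L^{q,\infty}(\mathbb D)$.
   Context: $\mathbb D$ is the open unit disc in $\mathbb C$, $dA$ is normalized area measure on $\mathbb D$, $|E|$ denotes the $dA$-measure of $E\subseteq\mathbb D$, and $L^p(\mathbb D)$ is taken with respect to $dA$. $\mathbb T$ is the unit circle with arc length normalized so that $|\mathbb T|=1$; $|I|$ is the normalized length of an arc $I$. A dyadic system on $\mathbb T$ is a collection of arcs $\mathcal D=\bigcup_{k\ge0}\mathcal D_k$ where each $\mathcal D_k$ consists of $2^k$ disjoint arcs of length $2^{-k}$ with union $\mathbb T$, and each arc of $\mathcal D_k$ is the union of two arcs of $\mathcal D_{k+1}$. The Carleson box of an arc $I\subseteq\mathbb T$ is $Q_I:=\{z\in\mathbb D: z/|z|\in I,\ 1-|I|\le|z|<1\}$ (the single point $z=0$ is a null set and plays no role). The dyadic hypersingular maximal operator is $$\mathcal M_t^{\mathcal D}f(z):=\sup_{I\in\mathcal D,\ z\in Q_I}\frac{1}{|Q_I|^t}\int_{Q_I}|f(w)|\,dA(w).$$ For $q<\infty$, $\|f\|_{L^{q,\infty}(\mathbb D)}:=\sup_{\lambda>0}\lambda|\{z\in\mathbb D:|f(z)|>\lambda\}|^{1/q}$; for $q=\infty$, $L^{\infty,\infty}(\mathbb D)=L^\infty(\mathbb D)$. Convention: $1/\infty=0$.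 "Bounded" means there is $C$ with $\|\mathcal M_t^{\mathcal D}f\|_{L^{q,\infty}(\mathbb D)}\le C\|f\|_{L^p(\mathbb D)}$ for all $f\in L^p(\mathbb D)$. *)

theory Defs
  imports "HOL-Probability.Essential_Supremum"
begin

text \<open>Normalized area measure on the open unit disc (whose Lebesgue measure is \<open>\<pi>\<close>).\<close>

definition disc_area :: "complex measure" where
  "disc_area = scale_measure (ennreal (1 / pi)) (lebesgue_on (ball 0 1))"

text \<open>Arcs may be open, closed or half-open; the library constant \<^term>\<open>arc\<close> is a
  predicate on injective paths and is not what is meant here.\<close>

definition circle_arc :: "complex set \<Rightarrow> bool" where
  "circle_arc I \<longleftrightarrow> (\<exists>J::real set. is_interval J \<and> I = (\<lambda>\<theta>. cis (2 * pi * \<theta>)) ` J)"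

definition arc_len :: "complex set \<Rightarrow> real" where
  "arc_len I = measure lebesgue {\<theta>\<in>{0..<1::real}. cis (2 * pi * \<theta>) \<in> I}"

text \<open>\<open>D k\<close> is the \<open>k\<close>-th generation; the dyadic system itself is \<open>\<Union>k. D k\<close>.\<close>

definition dyadic_system :: "(nat \<Rightarrow> complex set set) \<Rightarrow> bool" where
  "dyadic_system D \<longleftrightarrow>
     (\<forall>k. card (D k) = 2 ^ k \<and>
          (\<forall>I\<in>D k. circle_arc I \<and> arc_len I = 1 / 2 ^ k) \<and>
          disjoint (D k) \<and>
          \<Union>(D k) = sphere 0 1 \<and>
          (\<forall>I\<in>D k. \<exists>J\<in>D (Suc k). \<exists>K\<in>D (Suc k). J \<noteq> K \<and> I = J \<union> K))"

text \<open>As \<open>0 / 0 = 0\<close> does not lie on the circle, the origin belongs to no box.\<close>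

definition carleson_box :: "complex set \<Rightarrow> complex set" where
  "carleson_box I =
     {z \<in> ball 0 1. z / of_real (norm z) \<in> I \<and> 1 - arc_len I \<le> norm z \<and> norm z < 1}"

text \<open>The supremum may be infinite, so the operator takes values in \<^typ>\<open>ennreal\<close>.\<close>

definition dyadic_maximal ::
    "real \<Rightarrow> (nat \<Rightarrow> complex set set) \<Rightarrow> (complex \<Rightarrow> complex) \<Rightarrow> complex \<Rightarrow> ennreal" where
  "dyadic_maximal t D f z =
     (SUP I\<in>{I \<in> \<Union>(range D). z \<in> carleson_box I}.
        (\<integral>\<^sup>+w\<in>carleson_box I. ennreal (norm (f w)) \<partial>disc_area) /
        ennreal (measure disc_area (carleson_box I) powr t))"

text \<open>Exponents are extended reals; the definitions below are meant for \<open>1 \<le> p \<le> \<infinity>\<close>.\<close>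

definition Lp_space :: "ereal \<Rightarrow> (complex \<Rightarrow> complex) set" where
  "Lp_space p =
     {f \<in> borel_measurable disc_area.
        if p = \<infinity> then esssup disc_area (\<lambda>z. ennreal (norm (f z))) < \<infinity>
        else (\<integral>\<^sup>+z. ennreal (norm (f z) powr real_of_ereal p) \<partial>disc_area) < \<infinity>}"

definition Lp_norm :: "ereal \<Rightarrow> (complex \<Rightarrow> complex) \<Rightarrow> real" where
  "Lp_norm p f =
     (if p = \<infinity> then enn2real (esssup disc_area (\<lambda>z. ennreal (norm (f z))))
      else enn2real (\<integral>\<^sup>+z. ennreal (norm (f z) powr real_of_ereal p) \<partial>disc_area)
             powr (1 / real_of_ereal p))"

definition weak_Lq_norm :: "ereal \<Rightarrow> (complex \<Rightarrow> ennreal) \<Rightarrow> ennreal" where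
  "weak_Lq_norm q g =
     (if q = \<infinity> then esssup disc_area g
      else (SUP l\<in>{0::real<..}.
              ennreal (l * measure disc_area {z\<in>ball 0 1. g z > ennreal l}
                             powr (1 / real_of_ereal q))))"

definition bounded_Lp_weak_Lq ::
    "ereal \<Rightarrow> ereal \<Rightarrow> ((complex \<Rightarrow> complex) \<Rightarrow> complex \<Rightarrow> ennreal) \<Rightarrow> bool" where
  "bounded_Lp_weak_Lq p q T \<longleftrightarrow>
     (\<exists>C\<ge>0. \<forall>f\<in>Lp_space p. weak_Lq_norm q (T f) \<le> ennreal (C * Lp_norm p f))"

end

theory Submission
  imports Defs
begin

text \<open>
  The operator is tested on the indicator function of the annulus
  \<open>A = {1 - \<delta> \<le> |z| < 1}\<close> with \<open>\<delta> = 2\<^sup>-\<^sup>k\<close>. Testing on a single Carleson box would only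
  exclude \<open>1/q - 1/p < t - 1\<close>. Using all boxes of generation \<open>k\<close> at once doubles the range,
  because on each of them the maximal function is already as large as for that box alone, while
  the underlying set has measure comparable to \<open>\<delta>\<close> instead of \<open>\<delta>\<^sup>2\<close>.

  The boxes of generation \<open>k\<close> cover \<open>A\<close> (\<open>carleson_box_cover\<close>), and each has measure at most
  \<open>289 \<delta>\<^sup>2\<close> (\<open>measure_carleson_box_le\<close>). Taking the box itself as competitor in the supremum
  shows that the maximal function of the indicator is at least
  \<open>|Q|\<^sup>1\<^sup>-\<^sup>t \<ge> (289 \<delta>\<^sup>2)\<^sup>1\<^sup>-\<^sup>t\<close> on each box \<open>Q\<close> of positive measure
  (\<open>dyadic_maximal_ge\<close>), hence almost everywhere on \<open>A\<close>. As
  \<open>\<delta> \<le> |A| \<le> 2 \<delta>\<close>, the weak norm of the image is at least a constant times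
  \<open>\<delta>\<close> to the power \<open>2 - 2t + 1/q\<close> (\<open>weak_norm_annulus_ge\<close>), and the \<open>L\<^sup>p\<close> norm of the indicator
  is at most a constant times \<open>\<delta>\<close> to the power \<open>1/p\<close> (\<open>Lp_indicator\<close>). Boundedness would
  therefore keep \<open>\<delta>\<close> to the power \<open>2 - 2t + 1/q - 1/p\<close> bounded as \<open>\<delta> \<rightarrow> 0\<close>, although the exponent is
  negative.
\<close>

section \<open>Arcs of the circle\<close>

text \<open>
  Continuous images of Borel sets need not be Borel, but an interval is a countable union of compact
  intervals together with at most two endpoints.
\<close>

lemma borel_circle_arc:
  assumes "circle_arc I" shows "I \<in> sets borel"
proof -
  define e where "e = (\<lambda>\<theta>. cis (2 * pi * \<theta>))"
  obtain J where J: "is_interval J" "I = e ` J"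
    using assms unfolding circle_arc_def e_def by blast
  have cont: "continuous_on A e" for A
    unfolding e_def by (intro continuous_intros)
  obtain B :: "real set set" where B: "countable B" "\<And>X. X \<in> B \<Longrightarrow> \<exists>a b. X = cbox a b" "\<Union>B = interior J"
    using open_countable_Union_open_cbox[OF open_interior[of J]] by (smt (verit, best))
  have "e ` X \<in> sets borel" if "X \<in> B" for X
    using B(2)[OF that] compact_continuous_image[OF cont] compact_cbox
    by (metis borel_compact)
  then have "(\<Union>X\<in>B. e ` X) \<in> sets borel"
    using B(1) by (intro sets.countable_UN'') auto
  moreover have "(\<Union>X\<in>B. e ` X) = e ` interior J"
    using B(3) by blast
  ultimately have int: "e ` interior J \<in> sets borel"
    by simp
  \<comment> \<open>A point with elements of \<open>J\<close> on both sides is interior, so only endpoints are missed.\<close>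
  have "J - interior J \<subseteq> {x\<in>J. \<forall>y\<in>J. x \<le> y} \<union> {x\<in>J. \<forall>y\<in>J. y \<le> x}"
  proof (rule ccontr)
    assume "\<not> ?thesis"
    then obtain x y z where *: "x \<in> J" "x \<notin> interior J" "y \<in> J" "z \<in> J" "y < x" "x < z"
      by fastforce
    then have "{y<..<z} \<subseteq> J"
      using J(1) unfolding is_interval_1 by (meson greaterThanLessThan_iff less_imp_le subsetI)
    then have "x \<in> interior J"
      using * by (intro interiorI[of "{y<..<z}"]) auto
    with * show False by blast
  qed
  moreover have "countable ({x\<in>J. \<forall>y\<in>J. x \<le> y} \<union> {x\<in>J. \<forall>y\<in>J. y \<le> x})"
  proof -
    have "finite A" if "\<And>x y. x \<in> A \<Longrightarrow> y \<in> A \<Longrightarrow> x = y" for A :: "real set"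
    proof (cases "A = {}")
      case False
      then obtain a where "a \<in> A" by blast
      with that have "A = {a}" by blast
      then show ?thesis by simp
    qed simp
    then have "finite {x\<in>J. \<forall>y\<in>J. x \<le> y}" "finite {x\<in>J. \<forall>y\<in>J. y \<le> x}"
      by (metis (mono_tags, lifting) mem_Collect_eq order_antisym)+
    then show ?thesis by (simp add: countable_finite)
  qed
  ultimately have "countable (e ` (J - interior J))"
    by (meson countable_image countable_subset)
  then have "e ` (J - interior J) \<in> sets borel"
    by (rule sets.countable[rotated]) simp
  with int have "e ` interior J \<union> e ` (J - interior J) \<in> sets borel"
    by (rule sets.Un)
  moreover have "e ` interior J \<union> e ` (J - interior J) = I"
    using interior_subset[of J] J(2) by blast
  ultimately show ?thesis by simp
qed

lemma dist_cis_le: "dist (cis x) (cis y) \<le> \<bar>x - y\<bar>"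
proof -
  have "norm (exp (\<i> * of_real x) - exp (\<i> * of_real y)) \<le> 1 * norm (\<i> * of_real x - \<i> * of_real y)"
  proof (rule field_differentiable_bound[where S = "{z. Re z = 0}" and f' = exp])
    show "convex {z. Re z = 0}"
      by (rule convexI) simp
    show "(exp has_field_derivative exp z) (at z within {z. Re z = 0})" for z :: complex
      by (rule DERIV_subset[OF DERIV_exp]) simp
  qed auto
  also have "norm (\<i> * of_real x - \<i> * of_real y) = \<bar>x - y\<bar>"
    by (metis norm_ii norm_mult norm_of_real mult_1 of_real_diff right_diff_distrib)
  finally show ?thesis
    by (simp add: dist_norm cis_conv_exp)
qed

text \<open>
  The length of an arc is defined through its preimage in one period, whereas the size of a box is
  governed by the parameter interval \<open>J\<close>, which may wrap around the cut. Passing to half of a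
  piece of \<open>J\<close> avoids the cut, at the cost of a factor \<open>2\<close>; the bound on the length keeps \<open>J\<close> from
  covering a whole period.
\<close>

lemma arc_within_ball:
  assumes "circle_arc I" "0 < arc_len I" "arc_len I < 1 / 2"
  obtains c where "\<And>x. x \<in> I \<Longrightarrow> dist c x \<le> 4 * pi * arc_len I"
proof -
  define e where "e = (\<lambda>\<theta>. cis (2 * pi * \<theta>))"
  define S where "S = {\<theta>\<in>{0..<1::real}. e \<theta> \<in> I}"
  obtain J where J: "is_interval J" "I = e ` J"
    using assms unfolding circle_arc_def e_def by blast
  have L: "arc_len I = measure lebesgue S"
    by (simp add: arc_len_def S_def e_def)
  \<comment> \<open>The measure of a non-measurable set is \<open>0\<close> by convention.\<close>
  have "S \<in> sets lebesgue"
    using assms(2) L measure_notin_sets by force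
  moreover have "bounded S"
    by (rule bounded_subset[of "{0..1}"]) (auto simp: S_def)
  ultimately have S: "S \<in> lmeasurable"
    by (intro bounded_set_imp_lmeasurable)
  have short: "b - a \<le> 2 * arc_len I" if ab: "a \<in> J" "b \<in> J" "a \<le> b" "b - a \<le> 1" for a b
  proof -
    define m :: real and n :: int where "m = (a + b) / 2" and "n = \<lfloor>m\<rfloor>"
    have n: "n \<le> m" "m < n + 1"
      unfolding n_def by linarith+
    \<comment> \<open>Since \<open>b - a \<le> 1\<close>, one of the two halves of \<open>[a, b]\<close> has no integer in its interior,
        so that an integer translation moves it into \<open>[0, 1]\<close>.\<close>
    obtain u v :: real where uv: "v - u = (b - a) / 2" "a \<le> u" "v \<le> b" "n \<le> u" "v \<le> n + 1"
    proof (cases "b \<le> n + 1")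
      case True
      show ?thesis
        by (rule that[where u = m and v = b]) (use True ab n in \<open>auto simp: m_def field_simps\<close>)
    next
      case False
      show ?thesis
        by (rule that[where u = a and v = m]) (use False ab n in \<open>auto simp: m_def field_simps\<close>)
    qed
    have "{u - n..<v - n} \<subseteq> S"
    proof
      fix x assume x: "x \<in> {u - n..<v - n}"
      have "e x = e (x + n)"
        by (simp add: e_def distrib_left flip: cis_mult)
      moreover have "x + n \<in> J"
        using x uv ab J(1) unfolding is_interval_1 by (smt (verit, best) atLeastLessThan_iff)
      ultimately show "x \<in> S"
        using x uv J(2) by (auto simp: S_def)
    qed
    then have "measure lebesgue {u - n..<v - n} \<le> measure lebesgue S"
      using S by (intro measure_mono_fmeasurable) auto
    then show ?thesis
      using uv ab L by simp
  qed
  have "J \<noteq> {}"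
  proof
    assume "J = {}"
    then have "S = {}" using J(2) by (auto simp: S_def)
    with L assms(2) show False by simp
  qed
  have ordered: "b - a \<le> 2 * arc_len I" if ab: "a \<in> J" "b \<in> J" "a \<le> b" for a b
  proof (cases "b - a \<le> 1")
    case False
    then have "a + 1 \<in> J"
      using ab J(1) unfolding is_interval_1 by (smt (verit, best))
    then show ?thesis
      using short[of a "a + 1"] ab(1) assms(3) by simp
  qed (use short ab in simp)
  obtain a where a: "a \<in> J" using \<open>J \<noteq> {}\<close> by blast
  have "dist (e a) x \<le> 4 * pi * arc_len I" if "x \<in> I" for x
  proof -
    obtain b where b: "b \<in> J" "x = e b" using J(2) \<open>x \<in> I\<close> by blast
    have "\<bar>a - b\<bar> \<le> 2 * arc_len I"
      using ordered[of a b] ordered[of b a] a b by linarith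
    have "dist (e a) (e b) \<le> \<bar>2 * pi * a - 2 * pi * b\<bar>"
      unfolding e_def by (rule dist_cis_le)
    also have "\<dots> = 2 * pi * \<bar>a - b\<bar>"
      by (simp add: abs_mult flip: right_diff_distrib)
    also have "\<dots> \<le> 2 * pi * (2 * arc_len I)"
      using \<open>\<bar>a - b\<bar> \<le> 2 * arc_len I\<close> by (intro mult_left_mono) auto
    finally show ?thesis using b by simp
  qed
  then show ?thesis by (rule that)
qed

section \<open>Area of annuli and Carleson boxes\<close>

lemma space_disc_area: "space disc_area = ball 0 1"
  by (simp add: disc_area_def space_scale_measure)

lemma sets_disc_area: "A \<in> sets disc_area \<longleftrightarrow> A \<in> sets lebesgue \<and> A \<subseteq> ball 0 1"
  by (auto simp add: disc_area_def sets_restrict_space_iff)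

lemma emeasure_disc_area:
  "A \<subseteq> ball 0 1 \<Longrightarrow> emeasure disc_area A = ennreal (1 / pi) * emeasure lebesgue A"
  unfolding disc_area_def by (simp add: emeasure_restrict_space)

lemma measure_disc_area:
  "A \<subseteq> ball 0 1 \<Longrightarrow> measure disc_area A = measure lebesgue A / pi"
  unfolding measure_def by (simp add: emeasure_disc_area enn2real_mult)

lemma finite_measure_disc_area: "finite_measure disc_area"
proof
  have "emeasure lborel (ball 0 1 :: complex set) < \<infinity>"
    by (rule emeasure_lborel_ball_finite)
  then show "emeasure disc_area (space disc_area) \<noteq> \<infinity>"
    by (simp add: space_disc_area emeasure_disc_area ennreal_mult_eq_top_iff)
qed

lemma content_ball_complex: "0 \<le> r \<Longrightarrow> measure lebesgue (ball (c::complex) r) = pi * r\<^sup>2"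
  using content_ball[of r c] by (simp add: unit_ball_vol_2)

lemma measure_disc_area_annulus:
  assumes "0 \<le> r" "r \<le> 1"
  shows "measure disc_area (ball 0 1 - ball 0 r) = 1 - r\<^sup>2"
proof -
  have "measure lebesgue (ball 0 1 - ball 0 r :: complex set) = pi * 1\<^sup>2 - pi * r\<^sup>2"
    using assms content_ball_complex[of r 0] content_ball_complex[of 1 0]
    by (subst measurable_measure_Diff) auto
  then show ?thesis
    by (simp add: measure_disc_area field_simps)
qed

lemma sets_carleson_box:
  assumes "circle_arc I"
  shows "carleson_box I \<in> sets disc_area"
proof -
  have [measurable]: "I \<in> sets borel" by (rule borel_circle_arc) fact
  have "carleson_box I \<in> sets borel"
    unfolding carleson_box_def by measurable
  then show ?thesis
    by (auto simp: sets_disc_area carleson_box_def)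
qed

text \<open>
  Only the order of magnitude matters, and inclusion in a ball gives it without polar coordinates:
  a box over an arc of length \<open>L\<close> has angular extent \<open>O(L)\<close> and radial extent \<open>L\<close>.
  The constant is \<open>17\<^sup>2\<close>, as \<open>4 * pi + 1 < 17\<close>.
\<close>

lemma measure_carleson_box_le:
  assumes "circle_arc I" "0 < arc_len I" "arc_len I < 1 / 2"
  shows "measure disc_area (carleson_box I) \<le> 289 * (arc_len I)\<^sup>2"
proof -
  obtain c where c: "\<And>x. x \<in> I \<Longrightarrow> dist c x \<le> 4 * pi * arc_len I"
    using arc_within_ball[OF assms] by blast
  have "carleson_box I \<subseteq> ball c (17 * arc_len I)"
  proof
    fix z assume "z \<in> carleson_box I"
    then have z: "z / of_real (norm z) \<in> I" "1 - arc_len I \<le> norm z" "norm z < 1"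
      by (auto simp: carleson_box_def)
    have "z \<noteq> 0" using z(2) assms(3) by auto
    have "z / of_real (norm z) - z = z / of_real (norm z) * of_real (1 - norm z)"
      using \<open>z \<noteq> 0\<close> by (simp add: field_simps)
    then have "dist (z / of_real (norm z)) z = 1 - norm z"
      using \<open>z \<noteq> 0\<close> z(3) unfolding dist_norm
      by (simp add: norm_mult norm_divide del: of_real_diff)
    moreover have "dist c z \<le> dist c (z / of_real (norm z)) + dist (z / of_real (norm z)) z"
      by (rule dist_triangle)
    ultimately have "dist c z \<le> 4 * pi * arc_len I + arc_len I"
      using c[OF z(1)] z(2) by linarith
    also have "\<dots> = (4 * pi + 1) * arc_len I" by (simp add: algebra_simps)
    also have "\<dots> < 17 * arc_len I"
      using pi_less_4 assms(2) by (intro mult_strict_right_mono) auto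
    finally show "z \<in> ball c (17 * arc_len I)" by simp
  qed
  moreover have "carleson_box I \<in> sets lebesgue"
    using sets_carleson_box[OF assms(1)] by (simp add: sets_disc_area)
  ultimately have "measure lebesgue (carleson_box I) \<le> measure lebesgue (ball c (17 * arc_len I))"
    by (intro measure_mono_fmeasurable) auto
  also have "\<dots> = pi * (17 * arc_len I)\<^sup>2"
    using assms(2) by (intro content_ball_complex) auto
  finally show ?thesis
    by (subst measure_disc_area) (auto simp: carleson_box_def field_simps)
qed

lemma finite_dyadic_generation:
  assumes "dyadic_system D"
  shows "finite (D k)"
  using assms card.infinite[of "D k"] unfolding dyadic_system_def by fastforce

lemma carleson_box_cover:
  assumes "dyadic_system D" "1 \<le> k"
  shows "\<Union>(carleson_box ` D k) = ball 0 1 - ball 0 (1 - 1 / 2 ^ k)"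
proof -
  have len: "arc_len I = 1 / 2 ^ k" if "I \<in> D k" for I
    using assms that unfolding dyadic_system_def by blast
  have circ: "\<Union>(D k) = sphere 0 1"
    using assms unfolding dyadic_system_def by blast
  have "(1::real) / 2 ^ k < 1"
    using assms(2) by simp
  show ?thesis
  proof (intro equalityI subsetI)
    fix z assume "z \<in> \<Union>(carleson_box ` D k)"
    then show "z \<in> ball 0 1 - ball 0 (1 - 1 / 2 ^ k)"
      using len by (auto simp: carleson_box_def)
  next
    fix z :: complex assume z: "z \<in> ball 0 1 - ball 0 (1 - 1 / 2 ^ k)"
    then have "z \<noteq> 0" using \<open>(1::real) / 2 ^ k < 1\<close> by auto
    then have "z / of_real (norm z) \<in> \<Union>(D k)"
      unfolding circ by (simp add: norm_divide)
    then obtain I where "I \<in> D k" "z / of_real (norm z) \<in> I" by blast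
    then show "z \<in> \<Union>(carleson_box ` D k)"
      using z len by (auto simp: carleson_box_def not_less)
  qed
qed

section \<open>The maximal function and the norms\<close>

text \<open>
  In the supremum, a box contributes the same weight at each of its points, so a superlevel set
  is the union of the countably many boxes whose weight exceeds the level.
\<close>

lemma sets_superlevel_dyadic_maximal:
  assumes "dyadic_system D"
  shows "{z\<in>ball 0 1. dyadic_maximal t D f z > a} \<in> sets disc_area"
proof -
  define w where "w I = (\<integral>\<^sup>+w\<in>carleson_box I. ennreal (norm (f w)) \<partial>disc_area) /
        ennreal (measure disc_area (carleson_box I) powr t)" for I
  have "countable (\<Union>(range D))"
    using finite_dyadic_generation[OF assms] by (simp add: countable_finite)
  then have "countable {I\<in>\<Union>(range D). w I > a}"
    by (rule countable_subset[rotated]) blast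
  moreover have "carleson_box I \<in> sets disc_area" if "I \<in> \<Union>(range D)" for I
    using assms that unfolding dyadic_system_def by (intro sets_carleson_box) blast
  ultimately have "(\<Union>I\<in>{I\<in>\<Union>(range D). w I > a}. carleson_box I) \<in> sets disc_area"
    by (intro sets.countable_UN'') auto
  also have "(\<Union>I\<in>{I\<in>\<Union>(range D). w I > a}. carleson_box I) = {z\<in>ball 0 1. dyadic_maximal t D f z > a}"
    unfolding dyadic_maximal_def less_SUP_iff w_def by (auto simp: carleson_box_def)
  finally show ?thesis .
qed

text \<open>
  Positivity of the measure is essential: for a null box the quotient in the maximal function is
  \<open>0 / 0 = 0\<close>. The upper bound on the measure bounds the quotient from below, as \<open>1 - t < 0\<close>.
\<close>

lemma dyadic_maximal_ge:
  assumes "1 < t" "I \<in> D k" "z \<in> carleson_box I" "carleson_box I \<in> sets disc_area"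
    and f: "\<And>w. w \<in> carleson_box I \<Longrightarrow> norm (f w) = 1"
    and m: "0 < measure disc_area (carleson_box I)" "measure disc_area (carleson_box I) \<le> m"
  shows "ennreal (m powr (1 - t)) \<le> dyadic_maximal t D f z"
proof -
  interpret finite_measure disc_area by (rule finite_measure_disc_area)
  let ?m = "measure disc_area (carleson_box I)"
  have "(\<integral>\<^sup>+w\<in>carleson_box I. ennreal (norm (f w)) \<partial>disc_area) =
        (\<integral>\<^sup>+w. indicator (carleson_box I) w \<partial>disc_area)"
    by (intro nn_integral_cong) (auto simp: f split: split_indicator)
  also have "\<dots> = ennreal ?m"
    using assms(4) by (simp add: emeasure_eq_measure)
  finally have *: "(\<integral>\<^sup>+w\<in>carleson_box I. ennreal (norm (f w)) \<partial>disc_area) = ennreal ?m" .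
  have "ennreal (m powr (1 - t)) \<le> ennreal (?m powr (1 - t))"
    using assms(1) m by (intro ennreal_leI powr_mono2') auto
  also have "?m powr (1 - t) = ?m / ?m powr t"
    using m by (simp add: powr_diff)
  also have "ennreal (?m / ?m powr t) = ennreal ?m / ennreal (?m powr t)"
    using m by (intro divide_ennreal[symmetric]) auto
  also have "\<dots> \<le> dyadic_maximal t D f z"
    unfolding dyadic_maximal_def *[symmetric] using assms by (intro SUP_upper) auto
  finally show ?thesis .
qed

text \<open>
  For finite \<open>q\<close> the level \<open>l\<close> competes in the supremum that defines the weak norm. For \<open>q = \<infinity>\<close> the
  second factor is \<open>1\<close>, and the essential supremum cannot ignore the values on a set of positive
  measure. The superlevel set must be measurable, as \<^const>\<open>measure\<close> vanishes otherwise.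
\<close>

lemma weak_Lq_norm_ge:
  assumes "1 \<le> q" "0 < l" and m: "0 < m" "m \<le> measure disc_area E"
    and E: "E \<in> sets disc_area" "\<And>z. z \<in> E \<Longrightarrow> ennreal l < g z"
    and "{z\<in>ball 0 1. ennreal l < g z} \<in> sets disc_area"
  shows "ennreal (l * m powr real_of_ereal (1 / q)) \<le> weak_Lq_norm q g"
proof -
  interpret finite_measure disc_area by (rule finite_measure_disc_area)
  let ?S = "{z\<in>ball 0 1. ennreal l < g z}"
  have "E \<subseteq> ?S"
    using E by (auto simp: sets_disc_area)
  then have "measure disc_area E \<le> measure disc_area ?S"
    by (rule finite_measure_mono) fact
  with m(2) have mS: "m \<le> measure disc_area ?S"
    by (rule order_trans)
  show ?thesis
  proof (cases "q = \<infinity>")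
    case True
    have "ennreal l \<le> esssup disc_area g"
    proof (rule ccontr)
      assume "\<not> ?thesis"
      then have "z \<notin> E" if "g z \<le> esssup disc_area g" for z
        using E(2)[of z] that by force
      then have "AE z in disc_area. z \<notin> E"
        using esssup_AE[of g disc_area] by (auto elim: eventually_mono)
      then have "measure disc_area E = 0"
        using E(1) by (simp add: AE_iff_null_sets measure_eq_0_null_sets)
      with m show False by simp
    qed
    then show ?thesis
      using True m(1) by (simp add: weak_Lq_norm_def)
  next
    case False
    then obtain r where r: "q = ereal r" "1 \<le> r"
      using assms(1) by (cases q) auto
    have "ennreal (l * m powr (1 / r)) \<le> ennreal (l * measure disc_area ?S powr (1 / r))"
      using m mS r assms(2) by (intro ennreal_leI mult_left_mono powr_mono2) auto
    also have "\<dots> \<le> weak_Lq_norm q g"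
      unfolding weak_Lq_norm_def using r assms(2) by (auto intro!: SUP_upper)
    finally show ?thesis
      using r by (simp add: one_ereal_def)
  qed
qed

text \<open>
  For \<open>p = \<infinity>\<close> the right-hand side is \<open>1\<close> only if the set is not null, as \<open>0 powr 0 = 0\<close>.
\<close>

lemma Lp_indicator:
  assumes "1 \<le> p" "E \<in> sets disc_area" "0 < measure disc_area E"
  shows "indicator E \<in> Lp_space p"
    and "Lp_norm p (indicator E) \<le> measure disc_area E powr real_of_ereal (1 / p)"
proof -
  interpret finite_measure disc_area by (rule finite_measure_disc_area)
  have meas: "(indicator E :: complex \<Rightarrow> complex) \<in> borel_measurable disc_area"
    using assms(2) by simp
  have "indicator E \<in> Lp_space p \<and>
    Lp_norm p (indicator E) \<le> measure disc_area E powr real_of_ereal (1 / p)"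
  proof (cases "p = \<infinity>")
    case True
    have "esssup disc_area (\<lambda>z. ennreal (norm (indicator E z :: complex))) \<le> 1"
      by (rule esssup_I) (use assms(2) in \<open>auto split: split_indicator\<close>)
    moreover from this have "enn2real (esssup disc_area (\<lambda>z. ennreal (norm (indicator E z :: complex)))) \<le> 1"
      using enn2real_mono by fastforce
    ultimately show ?thesis
      using True meas assms(3) by (auto simp: Lp_space_def Lp_norm_def intro: le_less_trans)
  next
    case False
    then obtain r where r: "p = ereal r" "1 \<le> r"
      using assms(1) by (cases p) auto
    have "(\<integral>\<^sup>+z. ennreal (norm (indicator E z :: complex) powr r) \<partial>disc_area) =
          (\<integral>\<^sup>+z. indicator E z \<partial>disc_area)"
      by (intro nn_integral_cong) (auto split: split_indicator)
    also have "\<dots> = ennreal (measure disc_area E)"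
      using assms(2) by (simp add: emeasure_eq_measure)
    finally show ?thesis
      using r meas by (simp add: Lp_space_def Lp_norm_def one_ereal_def)
  qed
  then show "indicator E \<in> Lp_space p"
    and "Lp_norm p (indicator E) \<le> measure disc_area E powr real_of_ereal (1 / p)"
    by auto
qed

section \<open>The annulus as test set\<close>

text \<open>
  The level is half of the lower bound for the maximal function because the weak norm uses the strict
  superlevel set. Null boxes of generation \<open>k\<close> are discarded; there are finitely many boxes, so the
  remaining ones still have the full measure of the annulus.
\<close>

lemma weak_norm_annulus_ge:
  assumes "1 < t" "dyadic_system D" "1 \<le> q" "2 \<le> k"
  defines "\<delta> \<equiv> 1 / 2 ^ k :: real"
  defines "A \<equiv> ball 0 1 - ball 0 (1 - \<delta>) :: complex set"
  shows "ennreal ((289 * \<delta>\<^sup>2) powr (1 - t) / 2 * \<delta> powr real_of_ereal (1 / q)) \<le>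
     weak_Lq_norm q (dyadic_maximal t D (indicator A))"
proof -
  interpret finite_measure disc_area by (rule finite_measure_disc_area)
  have "(2::real) ^ 2 \<le> 2 ^ k"
    using assms(4) by (rule power_increasing) simp
  then have \<delta>: "0 < \<delta>" "\<delta> < 1 / 2"
    by (auto simp: \<delta>_def field_simps)
  have arcs: "circle_arc I" "arc_len I = \<delta>" if "I \<in> D k" for I
    using assms(2) that unfolding dyadic_system_def \<delta>_def by auto
  have box: "carleson_box I \<in> sets disc_area" if "I \<in> D k" for I
    using sets_carleson_box arcs that by blast
  have fin: "finite (D k)"
    using assms(2) by (rule finite_dyadic_generation)
  have cover: "\<Union>(carleson_box ` D k) = A"
    using carleson_box_cover[OF assms(2), of k] assms(4) by (simp add: A_def \<delta>_def)
  define P where "P = {I\<in>D k. 0 < measure disc_area (carleson_box I)}"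
  define E where "E = \<Union>(carleson_box ` P)"
  have E: "E \<in> sets disc_area"
    unfolding E_def P_def using fin box by (intro sets.finite_UN) auto
  have "\<Union>(carleson_box ` (D k - P)) \<in> null_sets disc_area"
    using fin box unfolding P_def
    by (intro null_sets_UN' countable_finite) (auto simp: null_sets_def emeasure_eq_measure zero_less_measure_iff)
  then have "measure disc_area (E \<union> \<Union>(carleson_box ` (D k - P))) = measure disc_area E"
    using E by (rule measure_Un_null_set[rotated])
  moreover have "E \<union> \<Union>(carleson_box ` (D k - P)) = A"
    unfolding cover[symmetric] E_def P_def by blast
  ultimately have "measure disc_area E = 1 - (1 - \<delta>)\<^sup>2"
    using \<delta> by (simp add: A_def measure_disc_area_annulus)
  also have "\<dots> \<ge> \<delta>"
    using \<delta> mult_left_mono[of \<delta> 1 \<delta>] by (simp add: power2_eq_square algebra_simps)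
  finally have mE: "\<delta> \<le> measure disc_area E" .
  define l where "l = (289 * \<delta>\<^sup>2) powr (1 - t) / 2"
  have "0 < l" using \<delta> by (simp add: l_def)
  have big: "ennreal l < dyadic_maximal t D (indicator A) z" if "z \<in> E" for z
  proof -
    obtain I where I: "I \<in> D k" "0 < measure disc_area (carleson_box I)" "z \<in> carleson_box I"
      using \<open>z \<in> E\<close> by (auto simp: E_def P_def)
    have "ennreal l < ennreal ((289 * \<delta>\<^sup>2) powr (1 - t))"
      using \<open>0 < l\<close> by (intro ennreal_lessI) (auto simp: l_def)
    also have "\<dots> \<le> dyadic_maximal t D (indicator A) z"
    proof (rule dyadic_maximal_ge[where D = D and k = k, OF assms(1) I(1,3) box[OF I(1)]])
      show "0 < measure disc_area (carleson_box I)" by fact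
      show "norm (indicator A w :: complex) = 1" if "w \<in> carleson_box I" for w
        using that I(1) cover by (auto simp: indicator_def)
      show "measure disc_area (carleson_box I) \<le> 289 * \<delta>\<^sup>2"
        using measure_carleson_box_le[of I] arcs[OF I(1)] \<delta> by simp
    qed
    finally show ?thesis .
  qed
  show ?thesis
    using weak_Lq_norm_ge[OF assms(3) \<open>0 < l\<close> \<delta>(1) mE E big
        sets_superlevel_dyadic_maximal[OF assms(2)]]
    by (simp add: l_def)
qed

theorem proposition3p9:
  fixes t :: real and D :: "nat \<Rightarrow> complex set set" and p q :: ereal
  assumes "1 < t" and "t < 3 / 2"
    and "dyadic_system D"
    and "1 \<le> p" and "1 \<le> q"
    and "1 / q - 1 / p < ereal (2 * t - 2)"
  shows "\<not> bounded_Lp_weak_Lq p q (dyadic_maximal t D)"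
proof
  assume "bounded_Lp_weak_Lq p q (dyadic_maximal t D)"
  then obtain C where C: "0 \<le> C"
    "\<And>f. f \<in> Lp_space p \<Longrightarrow> weak_Lq_norm q (dyadic_maximal t D f) \<le> ennreal (C * Lp_norm p f)"
    unfolding bounded_Lp_weak_Lq_def by blast
  define \<alpha> \<beta> where "\<alpha> = real_of_ereal (1 / p)" and "\<beta> = real_of_ereal (1 / q)"
  have "1 / p = ereal \<alpha>" "1 / q = ereal \<beta>" "0 \<le> \<alpha>"
    using assms(4,5) by (cases p; cases q; simp add: \<alpha>_def \<beta>_def one_ereal_def)+
  then have gap: "0 < 2 * t - 2 - \<beta> + \<alpha>"
    using assms(6) by simp
  define \<epsilon> where "\<epsilon> = 2 * t - 2 - \<beta> + \<alpha>"
  define K where "K = C * 2 powr \<alpha> * (2 * 289 powr (t - 1))"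
  have bound: "(2 powr \<epsilon>) ^ k \<le> K" if "2 \<le> k" for k
  proof -
    define \<delta> where "\<delta> = 1 / (2::real) ^ k"
    define A where "A = (ball 0 1 - ball 0 (1 - \<delta>) :: complex set)"
    have \<delta>: "0 < \<delta>" "\<delta> \<le> 1"
      by (auto simp: \<delta>_def)
    have A: "A \<in> sets disc_area"
      by (auto simp: A_def sets_disc_area)
    have "measure disc_area A = 1 - (1 - \<delta>)\<^sup>2"
      using \<delta> by (simp add: A_def measure_disc_area_annulus)
    also have "\<dots> = 2 * \<delta> - \<delta>\<^sup>2"
      by (simp add: power2_eq_square algebra_simps)
    finally have mA: "0 < measure disc_area A" "measure disc_area A \<le> 2 * \<delta>"
      using \<delta> mult_left_mono[of \<delta> 1 \<delta>] by (auto simp: power2_eq_square)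
    have "ennreal ((289 * \<delta>\<^sup>2) powr (1 - t) / 2 * \<delta> powr \<beta>) \<le>
        weak_Lq_norm q (dyadic_maximal t D (indicator A))"
      using weak_norm_annulus_ge[OF assms(1,3,5) that] by (simp add: A_def \<delta>_def \<beta>_def)
    also have "\<dots> \<le> ennreal (C * Lp_norm p (indicator A))"
      using Lp_indicator(1)[OF assms(4) A mA(1)] by (rule C(2))
    also have "\<dots> \<le> ennreal (C * (2 * \<delta>) powr \<alpha>)"
    proof (intro ennreal_leI mult_left_mono C(1))
      have "Lp_norm p (indicator A) \<le> measure disc_area A powr \<alpha>"
        unfolding \<alpha>_def by (rule Lp_indicator(2)[OF assms(4) A mA(1)])
      also have "\<dots> \<le> (2 * \<delta>) powr \<alpha>"
        using mA \<open>0 \<le> \<alpha>\<close> by (intro powr_mono2) auto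
      finally show "Lp_norm p (indicator A) \<le> (2 * \<delta>) powr \<alpha>" .
    qed
    finally have *: "(289 * \<delta>\<^sup>2) powr (1 - t) / 2 * \<delta> powr \<beta> \<le> C * (2 * \<delta>) powr \<alpha>"
      using C(1) by (subst (asm) ennreal_le_iff) auto
    have "(289 * \<delta>\<^sup>2) powr (1 - t) = \<delta> powr (2 - 2 * t) / 289 powr (t - 1)"
    proof -
      have "(289 * \<delta>\<^sup>2) powr (1 - t) = 289 powr (1 - t) * (\<delta> powr 2) powr (1 - t)"
        using \<delta> by (simp add: powr_mult)
      also have "(\<delta> powr 2) powr (1 - t) = \<delta> powr (2 - 2 * t)"
        by (simp add: powr_powr algebra_simps)
      also have "289 powr (1 - t) = 1 / (289::real) powr (t - 1)"
        by (metis minus_diff_eq powr_minus_divide)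
      finally show ?thesis by (simp add: algebra_simps)
    qed
    then have "\<delta> powr (2 - 2 * t) / 289 powr (t - 1) / 2 * \<delta> powr \<beta> \<le> C * (2 * \<delta>) powr \<alpha>"
      using * by simp
    then have "\<delta> powr (2 - 2 * t) * \<delta> powr \<beta> \<le> K * \<delta> powr \<alpha>"
      using \<delta> by (simp add: K_def powr_mult field_simps)
    then have "\<delta> powr (2 - 2 * t) * \<delta> powr \<beta> / \<delta> powr \<alpha> \<le> K"
      using \<delta> by (simp add: field_simps)
    then have "\<delta> powr (2 - 2 * t + \<beta> - \<alpha>) \<le> K"
      by (simp flip: powr_add powr_diff)
    moreover have "2 - 2 * t + \<beta> - \<alpha> = - \<epsilon>"
      by (simp add: \<epsilon>_def)
    ultimately have "\<delta> powr (- \<epsilon>) \<le> K"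
      by simp
    moreover have "\<delta> powr (- \<epsilon>) = (2 powr \<epsilon>) ^ k"
      by (simp add: \<delta>_def powr_minus powr_divide powr_realpow[symmetric] powr_powr mult.commute)
    ultimately show ?thesis by simp
  qed
  have "1 < 2 powr \<epsilon>"
    using gap by (simp add: \<epsilon>_def)
  then obtain n where n: "K < (2 powr \<epsilon>) ^ n"
    using real_arch_pow by blast
  \<comment> \<open>The bound needs arcs shorter than half the circle, hence generation at least \<open>2\<close>.\<close>
  also have "(2 powr \<epsilon>) ^ n \<le> (2 powr \<epsilon>) ^ (n + 2)"
    using \<open>1 < 2 powr \<epsilon>\<close> by (intro power_increasing) auto
  also have "\<dots> \<le> K"
    by (rule bound) simp
  finally show False by simp
qed

end
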